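(* Let $d\geq 1$ and let $P\subset\mathbb{R}^{d}$ be a convex polytope. Assume that for some $k$ with $1\leq k\leq d$, the $k$-th coordinate of each vertex of $P$ is rational, and that none of the edges of $P$ is contained in a hyperplane of the form $\{x\in\mathbb{R}^{d}: x_{k}=c\}$ with $c\in\mathbb{R}$. Then $P$ has an infinite set of orthogonal exponentials, i.e., there exists an infinite countable set $\Lambda\subset\mathbb{R}^{d}$ such that $\int_{P}e^{i\langle\lambda-\lambda',x\rangle}\,dx=0$ for all $\lambda,\lambda'\in\Lambda$ with $\lambda\neq\lambda'$.
   Context: A convex polytope in $\mathbb{R}^{d}$ is the convex hull of a finite set of points having positive Lebesgue measure. $\langle\cdot,\cdot\rangle$ is the standard scalar product. *)

theory Defs
  imports "HOL-Analysis.Analysis"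
begin

end

theory Submission
  imports Defs
begin

text \<open>Restricting the Fourier transform of P to the k-th coordinate axis gives F(t), the integral of
  exp(i t x_k) over P. Integrating first along a direction in which x_k is not constant turns t F(t)
  into a combination of integrals of the same kind over the upper and the lower faces, projected along
  that direction. Since no edge is orthogonal to the axis, this can be repeated down to the vertices,
  and t^d F(t) is an exponential sum with frequencies v_k, v a vertex. Evaluating at t = 0 shows that
  the coefficients add up to 0. If N is a common denominator of the v_k, all exponentials equal 1 at
  the integer multiples of 2 pi N, so F vanishes at the nonzero ones.\<close>

section \<open>Lebesgue measure on coordinate subspaces\<close>

text \<open>After one projection \<open>x_k\<close> is no longer a coordinate: on a projected face
  it survives only as an affine form. The induction therefore treats arbitrary forms
  \<open>\<alpha> \<bullet> x + \<beta>\<close> and keeps two invariants: the form is constant on no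
  face of positive dimension, and its values at the vertices lie in a fixed finite set
  \<open>R\<close>. The edge hypothesis yields the first invariant, which at each full-dimensional
  stage supplies a basis vector \<open>j\<close> with
  \<open>\<alpha> \<bullet> j \<noteq> 0\<close>; without it no power of t could be gained from that
  face. Since the dimension of a type cannot shrink during an induction, all polytopes stay in one
  space, inside the span of a set \<open>D\<close> of basis vectors, and
  \<open>coord_measure D\<close> serves as the Lebesgue measure of that span. The description of a
  chord by its upper and lower face is valid only for almost every line parallel to
  \<open>j\<close>, which is why null sets of the smaller measure have to be controlled.\<close>

definition coord_measure :: "'a::euclidean_space set \<Rightarrow> 'a measure"
  where "coord_measure D = distr (Pi\<^sub>M D (\<lambda>_. lborel)) borel (\<lambda>f. \<Sum>b\<in>D. f b *\<^sub>R b)"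

lemma coord_measure_Basis: "coord_measure Basis = lborel"
  unfolding coord_measure_def by (rule lborel_eq[symmetric])

lemma sets_coord_measure [simp, measurable_cong]: "sets (coord_measure D) = sets borel"
  by (simp add: coord_measure_def)

lemma space_coord_measure [simp]: "space (coord_measure D) = UNIV"
  by (simp add: coord_measure_def)

lemma measurable_coord_sum [measurable]:
  "(\<lambda>f. \<Sum>b\<in>D. f b *\<^sub>R b) \<in> borel_measurable (Pi\<^sub>M D (\<lambda>_. lborel :: real measure))"
  for D :: "'a::euclidean_space set"
  by measurable

lemma coord_sum_upd:
  fixes D :: "'a::euclidean_space set"
  assumes "finite D" "j \<notin> D"
  shows "(\<Sum>b\<in>insert j D. (f(j := s)) b *\<^sub>R b) = (\<Sum>b\<in>D. f b *\<^sub>R b) + s *\<^sub>R j"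
proof -
  have "(\<Sum>b\<in>D. (f(j := s)) b *\<^sub>R b) = (\<Sum>b\<in>D. f b *\<^sub>R b)"
    using assms by (intro sum.cong) auto
  then show ?thesis
    using assms by (simp add: add.commute)
qed

lemma nn_integral_coord_measure_insert:
  fixes D :: "'a::euclidean_space set"
  assumes "finite D" "j \<notin> D" and [measurable]: "g \<in> borel_measurable borel"
  shows "(\<integral>\<^sup>+x. g x \<partial>coord_measure (insert j D)) =
         (\<integral>\<^sup>+y. (\<integral>\<^sup>+s. g (y + s *\<^sub>R j) \<partial>lborel) \<partial>coord_measure D)"
proof -
  interpret product_sigma_finite "\<lambda>_::'a. lborel :: real measure" ..
  have "(\<integral>\<^sup>+x. g x \<partial>coord_measure (insert j D)) =
    (\<integral>\<^sup>+f. g (\<Sum>b\<in>insert j D. f b *\<^sub>R b) \<partial>Pi\<^sub>M (insert j D) (\<lambda>_. lborel))"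
    unfolding coord_measure_def by (subst nn_integral_distr) auto
  also have "\<dots> = (\<integral>\<^sup>+f. (\<integral>\<^sup>+s. g (\<Sum>b\<in>insert j D. (f(j := s)) b *\<^sub>R b) \<partial>lborel) \<partial>Pi\<^sub>M D (\<lambda>_. lborel))"
    by (rule product_nn_integral_insert) (use assms in auto)
  also have "\<dots> = (\<integral>\<^sup>+f. (\<integral>\<^sup>+s. g ((\<Sum>b\<in>D. f b *\<^sub>R b) + s *\<^sub>R j) \<partial>lborel) \<partial>Pi\<^sub>M D (\<lambda>_. lborel))"
    by (simp only: coord_sum_upd[OF assms(1,2)])
  also have "\<dots> = (\<integral>\<^sup>+y. (\<integral>\<^sup>+s. g (y + s *\<^sub>R j) \<partial>lborel) \<partial>coord_measure D)"
    unfolding coord_measure_def by (subst nn_integral_distr) auto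
  finally show ?thesis .
qed

text \<open>Fubini for the product measure, carried over by the summation map. Taking
  \<open>j\<close> as the inner variable reduces an integral over a polytope to its chords parallel
  to \<open>j\<close>.\<close>

lemma integral_coord_measure_insert:
  fixes D :: "'a::euclidean_space set" and g :: "'a \<Rightarrow> 'b::{banach, second_countable_topology}"
  assumes "finite D" "j \<notin> D" and g: "integrable (coord_measure (insert j D)) g"
  shows "(\<integral>x. g x \<partial>coord_measure (insert j D)) =
         (\<integral>y. (\<integral>s. g (y + s *\<^sub>R j) \<partial>lborel) \<partial>coord_measure D)"
proof -
  interpret product_sigma_finite "\<lambda>_::'a. lborel :: real measure" ..
  have [measurable]: "g \<in> borel_measurable borel"
    using borel_measurable_integrable[OF g] by simp
  have "(\<integral>x. g x \<partial>coord_measure (insert j D)) =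
    (\<integral>f. g (\<Sum>b\<in>insert j D. f b *\<^sub>R b) \<partial>Pi\<^sub>M (insert j D) (\<lambda>_. lborel))"
    unfolding coord_measure_def by (subst integral_distr) auto
  also have "\<dots> = (\<integral>f. (\<integral>s. g (\<Sum>b\<in>insert j D. (f(j := s)) b *\<^sub>R b) \<partial>lborel) \<partial>Pi\<^sub>M D (\<lambda>_. lborel))"
  proof (rule product_integral_insert)
    show "integrable (Pi\<^sub>M (insert j D) (\<lambda>_. lborel)) (\<lambda>f. g (\<Sum>b\<in>insert j D. f b *\<^sub>R b))"
      using g unfolding coord_measure_def by (subst (asm) integrable_distr_eq) auto
  qed (use assms in auto)
  also have "\<dots> = (\<integral>f. (\<integral>s. g ((\<Sum>b\<in>D. f b *\<^sub>R b) + s *\<^sub>R j) \<partial>lborel) \<partial>Pi\<^sub>M D (\<lambda>_. lborel))"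
    by (simp only: coord_sum_upd[OF assms(1,2)])
  also have "\<dots> = (\<integral>y. (\<integral>s. g (y + s *\<^sub>R j) \<partial>lborel) \<partial>coord_measure D)"
    unfolding coord_measure_def by (subst integral_distr) auto
  finally show ?thesis .
qed

lemma AE_coord_measure_span: "AE x in coord_measure D. x \<in> span D"
  for D :: "'a::euclidean_space set"
proof -
  have "closed (span D)" by (rule closed_subspace) (rule subspace_span)
  moreover have "(\<Sum>b\<in>D. f b *\<^sub>R b) \<in> span D" for f :: "'a \<Rightarrow> real"
    by (intro span_sum span_scale) (rule span_base)
  ultimately show ?thesis
    unfolding coord_measure_def by (subst AE_distr_iff) simp_all
qed

lemma inner_coord_sum:
  fixes D :: "'a::euclidean_space set"
  assumes "D \<subseteq> Basis" "c \<in> D"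
  shows "(\<Sum>b\<in>D. f b *\<^sub>R b) \<bullet> c = f c"
proof -
  have "(\<Sum>b\<in>D. f b *\<^sub>R b) \<bullet> c = (\<Sum>b\<in>D. if b = c then f b else 0)"
    unfolding inner_sum_left using assms by (intro sum.cong) (auto simp: inner_Basis subset_iff)
  also have "\<dots> = f c"
    using assms finite_subset[OF assms(1)] by simp
  finally show ?thesis .
qed

text \<open>For orthonormal \<open>D\<close> each coordinate is an inner product, hence bounded by
  the norm, so the preimage of a ball lies in a box. This makes the unimodular exponentials
  integrable on polytopes.\<close>

lemma emeasure_coord_measure_bounded:
  fixes D :: "'a::euclidean_space set"
  assumes "D \<subseteq> Basis" "bounded S"
  shows "emeasure (coord_measure D) S < \<infinity>"
proof -
  interpret product_sigma_finite "\<lambda>_::'a. lborel :: real measure" ..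
  have fin: "finite D" using assms(1) by (rule finite_subset) simp
  obtain B where B: "\<And>x. x \<in> S \<Longrightarrow> norm x \<le> B" and "B > 0"
    using assms(2) by (meson bounded_pos)
  let ?C = "cball 0 B :: 'a set"
  let ?E = "PiE D (\<lambda>_. {-B..B})"
  have "emeasure (coord_measure D) S \<le> emeasure (coord_measure D) ?C"
    using B by (intro emeasure_mono) (auto simp: dist_norm)
  also have "\<dots> = emeasure (Pi\<^sub>M D (\<lambda>_. lborel)) ((\<lambda>f. \<Sum>b\<in>D. f b *\<^sub>R b) -` ?C \<inter> space (Pi\<^sub>M D (\<lambda>_. lborel)))"
    unfolding coord_measure_def by (subst emeasure_distr) auto
  also have "\<dots> \<le> emeasure (Pi\<^sub>M D (\<lambda>_. lborel)) ?E"
  proof (rule emeasure_mono)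
    show "(\<lambda>f. \<Sum>b\<in>D. f b *\<^sub>R b) -` ?C \<inter> space (Pi\<^sub>M D (\<lambda>_. lborel)) \<subseteq> ?E"
    proof
      fix f assume f: "f \<in> (\<lambda>f. \<Sum>b\<in>D. f b *\<^sub>R b) -` ?C \<inter> space (Pi\<^sub>M D (\<lambda>_. lborel :: real measure))"
      have "\<bar>f c\<bar> \<le> B" if "c \<in> D" for c
      proof -
        have "\<bar>f c\<bar> \<le> norm (\<Sum>b\<in>D. f b *\<^sub>R b)"
          using Basis_le_norm[of c "\<Sum>b\<in>D. f b *\<^sub>R b"] inner_coord_sum[OF assms(1) that] that assms(1)
          by auto
        also have "\<dots> \<le> B" using f by (simp add: dist_norm)
        finally show ?thesis .
      qed
      then have "f c \<in> {-B..B}" if "c \<in> D" for c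
        using that by (force simp: abs_le_iff)
      then show "f \<in> ?E"
        using f by (auto simp: space_PiM PiE_iff)
    qed
    show "?E \<in> sets (Pi\<^sub>M D (\<lambda>_. lborel))"
      using fin by (intro sets_PiM_I_finite) auto
  qed
  also have "\<dots> = (\<Prod>b\<in>D. ennreal (2 * B))"
    using fin \<open>B > 0\<close> by (subst emeasure_PiM) auto
  also have "\<dots> < \<infinity>"
    by (simp add: ennreal_power less_top[symmetric] power_eq_top_ennreal)
  finally show ?thesis .
qed

text \<open>A nonzero normal in \<open>span D\<close> is not orthogonal to some \<open>j\<close> in
  \<open>D\<close>; each line parallel to \<open>j\<close> then meets the hyperplane in a single
  point, and Tonelli applies.\<close>

lemma null_sets_coord_measure_hyperplane:
  fixes D :: "'a::euclidean_space set"
  assumes "D \<subseteq> Basis" "a \<in> span D" "a \<noteq> 0"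
  shows "{x. a \<bullet> x = b} \<in> null_sets (coord_measure D)"
proof -
  have fin: "finite D" using assms(1) by (rule finite_subset) simp
  obtain j where j: "j \<in> D" "a \<bullet> j \<noteq> 0"
  proof -
    have "\<exists>j\<in>D. a \<bullet> j \<noteq> 0"
    proof (rule ccontr)
      assume "\<not> ?thesis"
      then have "orthogonal a a"
        using assms(2) by (intro orthogonal_to_span[of a D]) (auto simp: orthogonal_def)
      then show False
        using assms(3) by (simp add: orthogonal_def)
    qed
    then show ?thesis using that by blast
  qed
  define E where "E = D - {j}"
  have E: "insert j E = D" "finite E" "j \<notin> E"
    using j fin by (auto simp: E_def)
  have m: "{x. a \<bullet> x = b} \<in> sets borel"
    by (intro borel_closed closed_hyperplane)
  have "emeasure (coord_measure D) {x. a \<bullet> x = b} = (\<integral>\<^sup>+x. indicator {x. a \<bullet> x = b} x \<partial>coord_measure (insert j E))"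
    using m E by simp
  also have "\<dots> = (\<integral>\<^sup>+y. (\<integral>\<^sup>+s. indicator {x. a \<bullet> x = b} (y + s *\<^sub>R j) \<partial>lborel) \<partial>coord_measure E)"
    using m E by (intro nn_integral_coord_measure_insert) auto
  also have "\<dots> = (\<integral>\<^sup>+y. (\<integral>\<^sup>+s. indicator {(b - a \<bullet> y) / (a \<bullet> j)} s \<partial>lborel) \<partial>coord_measure E)"
    using j(2) by (intro nn_integral_cong) (auto simp: indicator_def inner_simps field_simps)
  also have "\<dots> = 0" by simp
  finally show ?thesis using m by (auto simp: null_sets_def)
qed

text \<open>Such a set lies in a hyperplane whose normal can be chosen inside \<open>span D\<close>.
  The almost-everywhere form spares any measurability question about \<open>S\<close>.\<close>

lemma AE_coord_measure_low_dim:
  fixes D :: "'a::euclidean_space set"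
  assumes D: "D \<subseteq> Basis" and S: "S \<subseteq> span D" "aff_dim S < int (card D)"
  shows "AE x in coord_measure D. x \<notin> S"
proof (cases "S = {}")
  case False
  then obtain p where p: "p \<in> S" by auto
  have ind: "independent D"
    using D independent_Basis independent_mono by blast
  have "(+) (-p) ` S \<subseteq> span D"
    using S(1) p by (auto simp: span_diff subset_iff)
  then have sub: "span ((+) (-p) ` S) \<subseteq> span D"
    by (metis span_mono span_span)
  have "dim ((+) (-p) ` S) < card D"
    using S(2) aff_dim_eq_dim[of p S] p by (simp add: hull_inc)
  then have "span ((+) (-p) ` S) \<noteq> span D"
    using dim_eq_card_independent[OF ind] by (metis dim_span less_irrefl)
  then obtain a where a: "a \<noteq> 0" "a \<in> span D" "\<And>y. y \<in> span ((+) (-p) ` S) \<Longrightarrow> orthogonal a y"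
    using orthogonal_to_subspace_exists_gen[of "(+) (-p) ` S" D] sub by blast
  have "a \<bullet> x = a \<bullet> p" if "x \<in> S" for x
    using a(3)[of "-p + x"] that by (auto simp: orthogonal_def inner_simps span_base)
  then have "S \<subseteq> {x. a \<bullet> x = a \<bullet> p}" by auto
  with AE_not_in[OF null_sets_coord_measure_hyperplane[OF D a(2,1), of "a \<bullet> p"]]
  show ?thesis by (auto elim: eventually_mono)
qed simp

section \<open>Upper faces and projection along a direction\<close>

text \<open>The fundamental theorem of calculus along a chord. The factor \<open>t * B\<close> is
  kept on the left instead of being divided out, so that t = 0 is covered.\<close>

lemma cis_affine_integral:
  fixes A B t l u :: real
  assumes "l \<le> u"
  shows "\<i> * of_real (t * B) * (\<integral>s. indicator {l..u} s *\<^sub>R cis (t * (A + s * B)) \<partial>lborel) =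
         cis (t * (A + u * B)) - cis (t * (A + l * B))"
proof -
  have "(\<integral>s. indicator {l..u} s *\<^sub>R (of_real (t * B) * (\<i> * cis (t * (A + s * B)))) \<partial>lborel) =
         cis (t * (A + u * B)) - cis (t * (A + l * B))"
  proof (rule integral_FTC_Icc[OF assms])
    show "((\<lambda>s. cis (t * (A + s * B))) has_vector_derivative
        of_real (t * B) * (\<i> * cis (t * (A + s * B)))) (at s within {l..u})" for s
      unfolding has_vector_derivative_def
      by (rule derivative_eq_intros refl | simp add: algebra_simps scaleR_conv_of_real)+
  qed (intro continuous_intros)
  moreover have "(\<lambda>s. indicator {l..u} s *\<^sub>R (of_real (t * B) * (\<i> * cis (t * (A + s * B))))) =
      (\<lambda>s. \<i> * of_real (t * B) * (indicator {l..u} s *\<^sub>R cis (t * (A + s * B))))"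
    by (simp add: fun_eq_iff scaleR_conv_of_real algebra_simps)
  ultimately show ?thesis
    by (simp only: integral_mult_right_zero)
qed

definition perp :: "'a::euclidean_space \<Rightarrow> 'a \<Rightarrow> 'a"
  where "perp j x = x - (x \<bullet> j) *\<^sub>R j"

lemma linear_perp: "linear (perp j)"
  by (auto simp: perp_def linear_iff algebra_simps inner_simps)

lemma perp_uminus [simp]: "perp (- j) = perp j"
  by (simp add: perp_def fun_eq_iff)

lemma perp_split: "x = perp j x + (x \<bullet> j) *\<^sub>R j"
  by (simp add: perp_def)

lemma perp_add_direction: "norm j = 1 \<Longrightarrow> perp j (x + s *\<^sub>R j) = perp j x"
  by (simp add: perp_def algebra_simps inner_simps norm_eq_1)

lemma inner_perp_self: "norm j = 1 \<Longrightarrow> perp j x \<bullet> j = 0"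
  by (simp add: perp_def algebra_simps inner_simps norm_eq_1)

lemma perp_in_span:
  fixes D :: "'a::euclidean_space set"
  assumes "insert j D \<subseteq> Basis" "j \<notin> D" "x \<in> span (insert j D)"
  shows "perp j x \<in> span D"
proof -
  obtain k where k: "x - k *\<^sub>R j \<in> span D"
    using assms(3) by (auto simp: span_insert)
  have "orthogonal j (x - k *\<^sub>R j)"
    using k by (rule orthogonal_to_span)
      (use assms in \<open>auto simp: orthogonal_def inner_Basis subset_iff\<close>)
  then have "x \<bullet> j = k"
    using assms(1) by (simp add: orthogonal_def inner_simps inner_commute)
  then show ?thesis using k by (simp add: perp_def)
qed

lemma perp_fix_span:
  fixes D :: "'a::euclidean_space set"
  assumes "insert j D \<subseteq> Basis" "j \<notin> D" "x \<in> span D"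
  shows "perp j x = x"
proof -
  have "orthogonal j x"
    using assms(3) by (rule orthogonal_to_span)
      (use assms in \<open>auto simp: orthogonal_def inner_Basis subset_iff\<close>)
  then show ?thesis by (simp add: orthogonal_def perp_def inner_commute)
qed

text \<open>A non-vertical hyperplane \<^term>\<open>{x. a \<bullet> x = b}\<close> is a graph over its projection along
  \<^term>\<open>j\<close>; extending the graph map to a shear of the whole space makes it injective, so that it
  transports faces.\<close>

definition shear :: "'a::euclidean_space \<Rightarrow> 'a \<Rightarrow> real \<Rightarrow> 'a \<Rightarrow> 'a"
  where "shear j a b y = y + ((b - perp j a \<bullet> y) / (a \<bullet> j)) *\<^sub>R j"

text \<open>On the hyperplane, \<open>a \<bullet> x = b\<close> can be solved for the component
  along \<open>j\<close>, so a projected face determines the original one.\<close>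

lemma shear_perp:
  assumes "norm j = 1" "a \<bullet> j \<noteq> 0" "a \<bullet> x = b"
  shows "shear j a b (perp j x) = x"
proof -
  have "b - perp j a \<bullet> perp j x = (x \<bullet> j) * (a \<bullet> j)"
    using assms inner_commute[of j x]
    by (simp add: perp_def norm_eq_1 inner_diff_left inner_diff_right)
  then show ?thesis
    using assms(2) perp_split[of x j] by (simp add: shear_def)
qed

lemma shear_image_perp:
  assumes "norm j = 1" "a \<bullet> j \<noteq> 0" "F \<subseteq> {x. a \<bullet> x = b}"
  shows "shear j a b ` perp j ` F = F"
proof -
  have "shear j a b (perp j x) = x" if "x \<in> F" for x
    using assms that by (intro shear_perp) auto
  then show ?thesis by (auto simp: image_image intro: rev_image_eqI)
qed

text \<open>The linear part changes a vector only by a multiple of \<open>j\<close>, so its kernel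
  consists of multiples of \<open>j\<close>; these it fixes, because \<open>perp j a\<close> is
  orthogonal to \<open>j\<close>. Hence it is injective, and faces and dimensions are
  preserved.\<close>

lemma shear_factor:
  assumes "norm j = 1"
  obtains h c where "linear h" "inj h" "\<And>S. shear j a b ` S = (+) c ` h ` S"
proof
  let ?h = "\<lambda>y. y - (perp j a \<bullet> y / (a \<bullet> j)) *\<^sub>R j"
  show lin: "linear ?h"
    by (auto simp: linear_iff algebra_simps inner_simps add_divide_distrib)
  show "inj ?h"
  proof (subst linear_injective_0[OF lin], intro allI impI)
    fix y assume "?h y = 0"
    then obtain c where y: "y = c *\<^sub>R j" by auto
    then have "perp j a \<bullet> y = 0"
      using assms by (simp add: inner_perp_self)
    with \<open>?h y = 0\<close> show "y = 0" by simp
  qed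
  show "shear j a b ` S = (+) ((b / (a \<bullet> j)) *\<^sub>R j) ` ?h ` S" for S
    unfolding image_image
    by (intro image_cong refl) (simp add: shear_def algebra_simps diff_divide_distrib)
qed

lemma face_of_shear:
  assumes "norm j = 1"
  shows "shear j a b ` G face_of shear j a b ` S \<longleftrightarrow> G face_of S"
proof -
  obtain h c where h: "linear h" "inj h" "\<And>S. shear j a b ` S = (+) c ` h ` S"
    using shear_factor[OF assms] by blast
  show ?thesis
    by (simp only: h(3) face_of_translation_eq face_of_linear_image[OF h(1,2)])
qed

lemma aff_dim_shear:
  assumes "norm j = 1"
  shows "aff_dim (shear j a b ` S) = aff_dim S"
proof -
  obtain h c where h: "linear h" "inj h" "\<And>S. shear j a b ` S = (+) c ` h ` S"
    using shear_factor[OF assms] by blast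
  show ?thesis
    by (simp only: h(3) aff_dim_translation_eq aff_dim_injective_linear_image[OF h(1,2)])
qed

text \<open>Source of the new form on a projected face: the pullback of an affine form along the
  graph map is affine again, with this gradient and constant.\<close>

lemma affine_form_shear:
  fixes \<alpha> a :: "'a::euclidean_space"
  shows "\<alpha> \<bullet> shear j a b y + \<beta> =
    (\<alpha> - (\<alpha> \<bullet> j / (a \<bullet> j)) *\<^sub>R perp j a) \<bullet> y + (\<beta> + \<alpha> \<bullet> j * b / (a \<bullet> j))"
  by (simp add: shear_def inner_simps algebra_simps diff_divide_distrib)

definition upper_faces :: "'a::euclidean_space \<Rightarrow> 'a set \<Rightarrow> 'a set set"
  where "upper_faces j Q = {F. F face_of Q \<and> F \<noteq> Q \<and>
    (\<exists>a b. Q \<subseteq> {x. a \<bullet> x \<le> b} \<and> F = Q \<inter> {x. a \<bullet> x = b} \<and> a \<bullet> j > 0)}"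

lemma finite_upper_faces: "polytope Q \<Longrightarrow> finite (upper_faces j Q)"
  by (rule finite_subset[OF _ finite_polytope_faces]) (auto simp: upper_faces_def)

lemma upper_face_top:
  assumes "F \<in> upper_faces j Q" "p \<in> F" "s > 0"
  shows "p + s *\<^sub>R j \<notin> Q"
proof
  assume q: "p + s *\<^sub>R j \<in> Q"
  obtain a b where ab: "Q \<subseteq> {x. a \<bullet> x \<le> b}" "F = Q \<inter> {x. a \<bullet> x = b}" "a \<bullet> j > 0"
    using assms(1) by (auto simp: upper_faces_def)
  then have "a \<bullet> p = b" "a \<bullet> (p + s *\<^sub>R j) \<le> b"
    using assms(2) q by auto
  then have "s * (a \<bullet> j) \<le> 0" by (simp add: inner_simps)
  then show False using ab(3) assms(3) by (simp add: mult_le_0_iff)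
qed

text \<open>Follow the ray from \<open>z\<close> to its last point in \<open>Q\<close>. That point
  lies on the relative frontier, hence in a proper face, which is exposed since \<open>Q\<close> is
  a polyhedron. The exposing functional is smaller at \<open>z\<close> than at the exit, so it
  increases along \<open>j\<close>.\<close>

lemma ex_upper_face:
  fixes Q :: "'a::euclidean_space set"
  assumes Q: "polytope Q" and z: "z \<in> rel_interior Q" and j: "norm j = 1"
    and dir: "\<And>x s. x \<in> affine hull Q \<Longrightarrow> x + s *\<^sub>R j \<in> affine hull Q"
  obtains u F where "u > 0" "F \<in> upper_faces j Q" "z + u *\<^sub>R j \<in> F"
proof -
  have zQ: "z \<in> Q" using z rel_interior_subset by blast
  let ?T = "{s. z + s *\<^sub>R j \<in> Q}"
  have "closed ?T"
  proof -
    have "?T = (\<lambda>s. z + s *\<^sub>R j) -` Q" by auto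
    moreover have "closed \<dots>"
      using polytope_imp_closed[OF Q] by (intro continuous_closed_vimage continuous_intros) auto
    ultimately show ?thesis by simp
  qed
  moreover have "bounded ?T"
  proof -
    obtain B where B: "\<And>x. x \<in> Q \<Longrightarrow> norm x \<le> B"
      using polytope_imp_bounded[OF Q] by (auto simp: bounded_iff)
    have "\<bar>s\<bar> \<le> B + norm z" if "s \<in> ?T" for s
    proof -
      have "\<bar>s\<bar> = norm ((z + s *\<^sub>R j) - z)" using j by simp
      also have "\<dots> \<le> norm (z + s *\<^sub>R j) + norm z" by (rule norm_triangle_ineq4)
      finally show ?thesis using B[of "z + s *\<^sub>R j"] that by simp
    qed
    then show ?thesis by (auto simp: bounded_iff)
  qed
  ultimately have "compact ?T" by (simp add: compact_eq_bounded_closed)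
  moreover have "?T \<noteq> {}" using zQ by (auto intro: exI[of _ 0])
  ultimately obtain u where u: "z + u *\<^sub>R j \<in> Q" "\<And>s. z + s *\<^sub>R j \<in> Q \<Longrightarrow> s \<le> u"
    using compact_attains_sup[of ?T] by auto
  \<comment> \<open>At a relative interior point a further small step along \<open>j\<close> would
    stay in \<open>Q\<close>, because \<open>dir\<close> keeps it in the affine hull; this
    contradicts the maximality of \<open>u\<close>.\<close>
  have not_int: "z + u *\<^sub>R j \<notin> rel_interior Q"
  proof
    assume "z + u *\<^sub>R j \<in> rel_interior Q"
    then obtain e where e: "e > 0" "cball (z + u *\<^sub>R j) e \<inter> affine hull Q \<subseteq> Q"
      by (auto simp: mem_rel_interior_cball)
    have "z + (u + e) *\<^sub>R j \<in> cball (z + u *\<^sub>R j) e"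
      using e(1) j by (simp add: dist_norm algebra_simps)
    moreover have "z + (u + e) *\<^sub>R j \<in> affine hull Q"
      using zQ by (intro dir hull_inc)
    ultimately have "z + (u + e) *\<^sub>R j \<in> Q"
      using e(2) by blast
    then show False
      using u(2)[of "u + e"] e(1) by simp
  qed
  have "u \<ge> 0" using u(2)[of 0] zQ by simp
  moreover have "u \<noteq> 0" using not_int z by auto
  ultimately have "u > 0" by simp
  have "z + u *\<^sub>R j \<in> rel_frontier Q"
    using u(1) not_int closure_subset by (auto simp: rel_frontier_def)
  then obtain F where F: "F face_of Q" "F \<noteq> Q" "z + u *\<^sub>R j \<in> F"
    using rel_frontier_of_polyhedron_alt[OF polytope_imp_polyhedron[OF Q]] by auto
  then have "F exposed_face_of Q"
    using exposed_face_of_polyhedron[OF polytope_imp_polyhedron[OF Q]] by auto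
  then obtain a b where ab: "Q \<subseteq> {x. a \<bullet> x \<le> b}" "F = Q \<inter> {x. a \<bullet> x = b}"
    by (auto simp: exposed_face_of_def)
  have "z \<notin> F" using face_of_disjoint_rel_interior[OF F(1,2)] z by auto
  then have "a \<bullet> z < b" using ab zQ by force
  moreover have "a \<bullet> z + u * (a \<bullet> j) = b" using F(3) ab(2) by (auto simp: inner_simps)
  ultimately have "u * (a \<bullet> j) > 0" by linarith
  then have "a \<bullet> j > 0" using \<open>u > 0\<close> by (simp add: zero_less_mult_iff)
  then have "F \<in> upper_faces j Q" using F ab by (auto simp: upper_faces_def)
  then show ?thesis using that \<open>u > 0\<close> F(3) by blast
qed

text \<open>Only one upper face lies over a generic point. Two of them at different heights on the
  line contradict \<open>upper_face_top\<close>; at equal height they share the point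
  \<open>p\<close>, which \<open>disj\<close> excludes.\<close>

lemma sum_upper_faces:
  fixes g :: "'a::euclidean_space set \<Rightarrow> complex"
  assumes Q: "polytope Q" and j: "norm j = 1" and F: "F \<in> upper_faces j Q" and p: "p \<in> F"
    and disj: "\<And>G H. \<lbrakk>G face_of Q; G \<noteq> Q; H face_of Q; H \<noteq> Q; G \<noteq> H\<rbrakk> \<Longrightarrow> perp j p \<notin> perp j ` (G \<inter> H)"
  shows "(\<Sum>G\<in>upper_faces j Q. indicator (perp j ` G) (perp j p) *\<^sub>R g G) = g F"
proof -
  have "perp j p \<notin> perp j ` G" if G: "G \<in> upper_faces j Q" "G \<noteq> F" for G
  proof
    assume "perp j p \<in> perp j ` G"
    then obtain x where x: "x \<in> G" "perp j x = perp j p" by auto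
    have xp: "x = p + (x \<bullet> j - p \<bullet> j) *\<^sub>R j" and px: "p = x + (p \<bullet> j - x \<bullet> j) *\<^sub>R j"
      using x(2) perp_split[of x j] perp_split[of p j] by (simp_all add: algebra_simps perp_def)
    have in_Q: "x \<in> Q" "p \<in> Q"
      using G(1) F x(1) p by (auto simp: upper_faces_def)
    consider "x \<bullet> j - p \<bullet> j > 0" | "p \<bullet> j - x \<bullet> j > 0" | "x \<bullet> j = p \<bullet> j"
      by linarith
    then show False
    proof cases
      case 1
      show False using upper_face_top[OF F p 1] xp in_Q by simp
    next
      case 2
      show False using upper_face_top[OF G(1) x(1) 2] px in_Q by simp
    next
      case 3
      then have "x = p" using xp by simp
      then have "perp j p \<in> perp j ` (G \<inter> F)" using x p by auto
      moreover have "perp j p \<notin> perp j ` (G \<inter> F)"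
        using G F by (intro disj) (auto simp: upper_faces_def)
      ultimately show False by contradiction
    qed
  qed
  then have "(\<Sum>G\<in>upper_faces j Q - {F}. indicator (perp j ` G) (perp j p) *\<^sub>R g G) = 0"
    by (intro sum.neutral) auto
  then show ?thesis
    using p by (subst sum.remove[OF finite_upper_faces[OF Q] F]) simp
qed

text \<open>The line over \<open>y\<close> meets \<open>Q\<close> in a segment whose ends lie on one
  upper and one lower face. By \<open>form\<close>, the two boundary values of the antiderivative
  are the projected exponentials of these faces.\<close>

lemma line_integral_polytope:
  fixes Q :: "'a::euclidean_space set"
  assumes Q: "polytope Q" and j: "norm j = 1"
    and dir: "\<And>x s. x \<in> affine hull Q \<Longrightarrow> x + s *\<^sub>R j \<in> affine hull Q"
    and y: "y \<in> rel_interior (perp j ` Q)"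
    and disj: "\<And>G H. \<lbrakk>G face_of Q; G \<noteq> Q; H face_of Q; H \<noteq> Q; G \<noteq> H\<rbrakk> \<Longrightarrow> y \<notin> perp j ` (G \<inter> H)"
    and form: "\<And>F x. F \<in> upper_faces j Q \<union> upper_faces (- j) Q \<Longrightarrow> x \<in> F \<Longrightarrow>
      \<alpha>' F \<bullet> perp j x + \<beta>' F = \<alpha> \<bullet> x + \<beta>"
  shows "\<i> * of_real (t * (\<alpha> \<bullet> j)) *
      (\<integral>s. indicator Q (y + s *\<^sub>R j) *\<^sub>R cis (t * (\<alpha> \<bullet> (y + s *\<^sub>R j) + \<beta>)) \<partial>lborel) =
    (\<Sum>F\<in>upper_faces j Q. indicator (perp j ` F) y *\<^sub>R cis (t * (\<alpha>' F \<bullet> y + \<beta>' F))) -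
    (\<Sum>F\<in>upper_faces (- j) Q. indicator (perp j ` F) y *\<^sub>R cis (t * (\<alpha>' F \<bullet> y + \<beta>' F)))"
proof -
  have cQ: "convex Q" using Q by (rule polytope_imp_convex)
  \<comment> \<open>Relative interiors of convex sets commute with linear maps, so \<open>y\<close>
    lifts to a relative interior point of \<open>Q\<close>, from which both ends can be
    reached.\<close>
  have "y \<in> perp j ` rel_interior Q"
    using y rel_interior_convex_linear_image[OF linear_perp cQ] by simp
  then obtain z where z: "z \<in> rel_interior Q" "perp j z = y" by auto
  define m where "m = z \<bullet> j"
  have zy: "z = y + m *\<^sub>R j" using z(2) perp_split[of z j] by (simp add: m_def)
  obtain u F where u: "u > 0" "F \<in> upper_faces j Q" "z + u *\<^sub>R j \<in> F"
    using ex_upper_face[OF Q z(1) j dir] by blast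
  have j': "norm (- j) = 1" using j by simp
  have dir': "x + s *\<^sub>R (- j) \<in> affine hull Q" if "x \<in> affine hull Q" for x s
    using dir[OF that, of "- s"] by simp
  obtain l G where l: "l > 0" "G \<in> upper_faces (- j) Q" "z + l *\<^sub>R (- j) \<in> G"
    using ex_upper_face[OF Q z(1) j' dir'] by blast
  have pu: "perp j (z + u *\<^sub>R j) = y" and pl: "perp j (z + l *\<^sub>R (- j)) = y"
    using perp_add_direction[OF j, of z u] perp_add_direction[OF j, of z "- l"] z(2) by auto
  have inQ: "z + u *\<^sub>R j \<in> Q" "z + l *\<^sub>R (- j) \<in> Q"
    using u l by (auto simp: upper_faces_def)
  have slice: "y + s *\<^sub>R j \<in> Q \<longleftrightarrow> s \<in> {m - l..m + u}" for s
  proof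
    assume s: "y + s *\<^sub>R j \<in> Q"
    have "s \<le> m + u"
    proof (rule ccontr)
      assume "\<not> s \<le> m + u"
      then have "(z + u *\<^sub>R j) + (s - m - u) *\<^sub>R j \<notin> Q"
        by (intro upper_face_top[OF u(2,3)]) simp
      then show False using s by (simp add: zy algebra_simps)
    qed
    moreover have "m - l \<le> s"
    proof (rule ccontr)
      assume "\<not> m - l \<le> s"
      then have "(z + l *\<^sub>R (- j)) + (m - l - s) *\<^sub>R (- j) \<notin> Q"
        by (intro upper_face_top[OF l(2,3)]) simp
      then show False using s by (simp add: zy algebra_simps)
    qed
    ultimately show "s \<in> {m - l..m + u}" by simp
  next
    assume s: "s \<in> {m - l..m + u}"
    \<comment> \<open>The relative position of \<open>s\<close> between the lower end
      \<open>m - l\<close> and the upper end \<open>m + u\<close>, i.e. the weight in the convex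
      combination of the two end points.\<close>
    define v where "v = (s - (m - l)) / (u + l)"
    have v: "0 \<le> v" "v \<le> 1" using s u l by (auto simp: v_def divide_simps)
    have vs: "v * (u + l) = s - m + l" using u l by (simp add: v_def)
    have "(1 - v) *\<^sub>R (z + l *\<^sub>R (- j)) + v *\<^sub>R (z + u *\<^sub>R j) \<in> Q"
      using cQ inQ v by (intro convexD_alt) auto
    also have "(1 - v) *\<^sub>R (z + l *\<^sub>R (- j)) + v *\<^sub>R (z + u *\<^sub>R j) = z + (v * (u + l) - l) *\<^sub>R j"
      by (simp add: algebra_simps)
    also have "\<dots> = y + s *\<^sub>R j"
      unfolding vs by (simp add: zy algebra_simps)
    finally show "y + s *\<^sub>R j \<in> Q" .
  qed
  have "(\<Sum>F\<in>upper_faces j Q. indicator (perp j ` F) y *\<^sub>R cis (t * (\<alpha>' F \<bullet> y + \<beta>' F))) =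
      cis (t * (\<alpha>' F \<bullet> y + \<beta>' F))"
    using sum_upper_faces[OF Q j u(2,3), of "\<lambda>F. cis (t * (\<alpha>' F \<bullet> y + \<beta>' F))"] disj
    unfolding pu by blast
  also have "\<alpha>' F \<bullet> y + \<beta>' F = \<alpha> \<bullet> (z + u *\<^sub>R j) + \<beta>"
    using form[of F "z + u *\<^sub>R j"] u pu by simp
  also have "\<dots> = (\<alpha> \<bullet> y + \<beta>) + (m + u) * (\<alpha> \<bullet> j)"
    by (simp add: zy inner_simps algebra_simps)
  finally have top: "(\<Sum>F\<in>upper_faces j Q. indicator (perp j ` F) y *\<^sub>R cis (t * (\<alpha>' F \<bullet> y + \<beta>' F))) =
      cis (t * ((\<alpha> \<bullet> y + \<beta>) + (m + u) * (\<alpha> \<bullet> j)))" .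
  have "(\<Sum>F\<in>upper_faces (- j) Q. indicator (perp j ` F) y *\<^sub>R cis (t * (\<alpha>' F \<bullet> y + \<beta>' F))) =
      cis (t * (\<alpha>' G \<bullet> y + \<beta>' G))"
    using sum_upper_faces[OF Q j' l(2,3), of "\<lambda>F. cis (t * (\<alpha>' F \<bullet> y + \<beta>' F))"] disj
    unfolding perp_uminus pl by blast
  also have "\<alpha>' G \<bullet> y + \<beta>' G = \<alpha> \<bullet> (z + l *\<^sub>R (- j)) + \<beta>"
    using form[of G "z + l *\<^sub>R (- j)"] l pl by simp
  also have "\<dots> = (\<alpha> \<bullet> y + \<beta>) + (m - l) * (\<alpha> \<bullet> j)"
    by (simp add: zy inner_simps algebra_simps)
  finally have bot: "(\<Sum>F\<in>upper_faces (- j) Q. indicator (perp j ` F) y *\<^sub>R cis (t * (\<alpha>' F \<bullet> y + \<beta>' F))) =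
      cis (t * ((\<alpha> \<bullet> y + \<beta>) + (m - l) * (\<alpha> \<bullet> j)))" .
  have "(\<lambda>s. indicator Q (y + s *\<^sub>R j) *\<^sub>R cis (t * (\<alpha> \<bullet> (y + s *\<^sub>R j) + \<beta>))) =
      (\<lambda>s. indicator {m - l..m + u} s *\<^sub>R cis (t * ((\<alpha> \<bullet> y + \<beta>) + s * (\<alpha> \<bullet> j))))"
    using slice by (auto simp: fun_eq_iff indicator_def inner_simps algebra_simps)
  moreover have "m - l \<le> m + u" using u l by simp
  ultimately show ?thesis
    unfolding top bot by (simp only: cis_affine_integral)
qed

section \<open>Dimension bounds and generic lines\<close>

lemma affine_hull_full_dim_span:
  fixes D :: "'a::euclidean_space set"
  assumes "D \<subseteq> Basis" "Q \<subseteq> span D" "aff_dim Q = int (card D)"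
  shows "affine hull Q = span D"
proof -
  have "independent D" using assms(1) independent_Basis independent_mono by blast
  then have "aff_dim Q = aff_dim (span D)"
    using assms(3) by (simp add: aff_dim_subspace dim_eq_card_independent)
  then have "affine hull Q = affine hull (span D)"
    using aff_dim_eq_full_gen[OF assms(2)] by simp
  then show ?thesis
    by (simp add: affine_hull_eq subspace_imp_affine)
qed

lemma aff_dim_le_card:
  fixes D :: "'a::euclidean_space set"
  assumes "D \<subseteq> Basis" "S \<subseteq> span D"
  shows "aff_dim S \<le> int (card D)"
proof -
  have "independent D" using assms(1) independent_Basis independent_mono by blast
  then show ?thesis
    using aff_dim_subset[OF assms(2)] by (simp add: aff_dim_subspace dim_eq_card_independent)
qed

text \<open>The exceptional points form a finite union of sets of dimension below
  \<open>card D\<close>: the proper faces of the projection, which make up its relative frontier,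
  and the projected intersections of distinct proper faces.\<close>

lemma AE_generic_line:
  fixes D :: "'a::euclidean_space set"
  assumes D: "insert j D \<subseteq> Basis" "j \<notin> D" and Q: "polytope Q" "Q \<subseteq> span (insert j D)"
  shows "AE y in coord_measure D. y \<in> span D \<and> (y \<in> perp j ` Q \<longrightarrow> y \<in> rel_interior (perp j ` Q)) \<and>
    (\<forall>G H. G face_of Q \<and> G \<noteq> Q \<and> H face_of Q \<and> H \<noteq> Q \<and> G \<noteq> H \<longrightarrow> y \<notin> perp j ` (G \<inter> H))"
proof -
  have DB: "D \<subseteq> Basis" and fD: "finite D"
    using D finite_subset[of D Basis] by auto
  let ?P = "perp j ` Q"
  have P: "polytope ?P" using Q(1) linear_perp by (rule polytope_linear_image[rotated])
  have PD: "?P \<subseteq> span D" using Q(2) perp_in_span[OF D] by auto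
  have "AE y in coord_measure D. y \<notin> S" if "S \<in> {S. S face_of ?P \<and> S \<noteq> ?P}" for S
  proof (rule AE_coord_measure_low_dim[OF DB])
    have S: "S face_of ?P" "S \<noteq> ?P" using that by auto
    show "S \<subseteq> span D" using S(1) PD face_of_imp_subset by blast
    show "aff_dim S < int (card D)"
      using face_of_aff_dim_lt[OF polytope_imp_convex[OF P] S] aff_dim_le_card[OF DB PD] by simp
  qed
  then have 1: "AE y in coord_measure D. \<forall>S \<in> {S. S face_of ?P \<and> S \<noteq> ?P}. y \<notin> S"
    using finite_polytope_faces[OF P]
    by (intro AE_finite_allI) (auto intro: rev_finite_subset)
  let ?I = "{(G, H). G face_of Q \<and> G \<noteq> Q \<and> H face_of Q \<and> H \<noteq> Q \<and> G \<noteq> H}"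
  \<comment> \<open>The dimension drops twice, from \<open>Q\<close> to \<open>G\<close> and from
    \<open>G\<close> to \<open>G \<inter> H\<close>, which absorbs the extra direction
    \<open>j\<close>. For distinct faces at least one inclusion fails, so the claim applies after a
    possible swap.\<close>
  have dim_lt: "aff_dim (G \<inter> H) < int (card D)"
    if GH: "G face_of Q" "G \<noteq> Q" "H face_of Q" "\<not> G \<subseteq> H" for G H
  proof -
    have "aff_dim Q \<le> int (card (insert j D))"
      by (rule aff_dim_le_card[OF D(1) Q(2)])
    moreover have "aff_dim G < aff_dim Q"
      by (rule face_of_aff_dim_lt[OF polytope_imp_convex[OF Q(1)] GH(1,2)])
    moreover have "aff_dim (G \<inter> H) < aff_dim G"
    proof (rule face_of_aff_dim_lt)
      show "convex G" using GH(1) by (rule face_of_imp_convex)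
      show "G \<inter> H face_of G" 
        using GH(1,3) by (meson face_of_Int face_of_subset face_of_imp_subset inf_le1)
      show "G \<inter> H \<noteq> G" using GH(4) by auto
    qed
    ultimately show ?thesis using D(2) fD by simp
  qed
  have "AE y in coord_measure D. y \<notin> perp j ` (fst X \<inter> snd X)" if X_in: "X \<in> ?I" for X
  proof (rule AE_coord_measure_low_dim[OF DB])
    obtain G H where X: "X = (G, H)" "G face_of Q" "G \<noteq> Q" "H face_of Q" "H \<noteq> Q" "G \<noteq> H"
      using X_in by auto
    show "perp j ` (fst X \<inter> snd X) \<subseteq> span D"
      using X(1,2) PD face_of_imp_subset by fastforce
    have "aff_dim (perp j ` (G \<inter> H)) \<le> aff_dim (G \<inter> H)"
      by (rule aff_dim_linear_image_le[OF linear_perp])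
    moreover have "aff_dim (G \<inter> H) < int (card D)"
      using dim_lt[of G H] dim_lt[of H G] X by (metis inf_commute subset_antisym)
    ultimately show "aff_dim (perp j ` (fst X \<inter> snd X)) < int (card D)"
      using X(1) by simp
  qed
  moreover have "finite ?I"
    by (rule finite_subset[of _ "{F. F face_of Q} \<times> {F. F face_of Q}"])
      (use finite_polytope_faces[OF Q(1)] in auto)
  ultimately have 2: "AE y in coord_measure D. \<forall>X \<in> ?I. y \<notin> perp j ` (fst X \<inter> snd X)"
    by (intro AE_finite_allI) auto
  show ?thesis
    using 1 2 AE_coord_measure_span[of D]
  proof eventually_elim
    case (elim y)
    have "y \<in> rel_interior ?P" if "y \<in> ?P"
    proof (rule ccontr)
      assume "y \<notin> rel_interior ?P"
      then have "y \<in> rel_frontier ?P"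
        using that closure_subset[of ?P] by (auto simp: rel_frontier_def)
      then show False
        using elim(1) rel_frontier_of_polyhedron_alt[OF polytope_imp_polyhedron[OF P]] by auto
    qed
    then show ?case using elim(2,3) by fastforce
  qed
qed

section \<open>Fourier transform of a polytope along an axis\<close>

lemma set_integrable_cis_coord_measure:
  fixes D :: "'a::euclidean_space set"
  assumes "D \<subseteq> Basis" "polytope Q"
  shows "set_integrable (coord_measure D) Q (\<lambda>x. cis (t * (\<alpha> \<bullet> x + \<beta>)))"
  unfolding set_integrable_def
proof (rule integrableI_bounded_set_indicator[where B = 1])
  show "Q \<in> sets (coord_measure D)"
    using polytope_imp_closed[OF assms(2)] by simp
  show "emeasure (coord_measure D) Q < \<infinity>"
    using assms(1) polytope_imp_bounded[OF assms(2)] by (rule emeasure_coord_measure_bounded)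
  have "(\<lambda>x. cis (t * (\<alpha> \<bullet> x + \<beta>))) \<in> borel_measurable borel"
    by (intro borel_measurable_continuous_onI continuous_intros)
  then show "(\<lambda>x. cis (t * (\<alpha> \<bullet> x + \<beta>))) \<in> borel_measurable (coord_measure D)"
    by simp
qed simp

text \<open>In effect the divergence theorem for the constant field \<open>j\<close>, with the
  boundary measured by its projection along \<open>j\<close>. It follows from Fubini and the chord
  formula on almost every line.\<close>

lemma fourier_slice_polytope:
  fixes Q :: "'a::euclidean_space set"
  assumes D: "insert j D \<subseteq> Basis" "j \<notin> D"
    and Q: "polytope Q" "Q \<subseteq> span (insert j D)" "aff_dim Q = int (card (insert j D))"
    and form: "\<And>F x. F \<in> upper_faces j Q \<union> upper_faces (- j) Q \<Longrightarrow> x \<in> F \<Longrightarrow>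
      \<alpha>' F \<bullet> perp j x + \<beta>' F = \<alpha> \<bullet> x + \<beta>"
  shows "\<i> * of_real (t * (\<alpha> \<bullet> j)) * (LINT x:Q|coord_measure (insert j D). cis (t * (\<alpha> \<bullet> x + \<beta>))) =
    (\<Sum>F\<in>upper_faces j Q. LINT y:perp j ` F|coord_measure D. cis (t * (\<alpha>' F \<bullet> y + \<beta>' F))) -
    (\<Sum>F\<in>upper_faces (- j) Q. LINT y:perp j ` F|coord_measure D. cis (t * (\<alpha>' F \<bullet> y + \<beta>' F)))"
proof -
  have DB: "D \<subseteq> Basis" and fD: "finite D"
    using D finite_subset[of D Basis] by auto
  have j: "norm j = 1" using D(1) by (simp add: norm_Basis)
  have aff: "affine hull Q = span (insert j D)"
    by (rule affine_hull_full_dim_span[OF D(1) Q(2,3)])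
  have dir: "x + s *\<^sub>R j \<in> affine hull Q" if "x \<in> affine hull Q" for x s
    using that unfolding aff by (intro span_add span_scale) (auto intro: span_base)
  let ?g = "\<lambda>x. indicator Q x *\<^sub>R cis (t * (\<alpha> \<bullet> x + \<beta>))"
  let ?f = "\<lambda>F y. indicator (perp j ` F) y *\<^sub>R cis (t * (\<alpha>' F \<bullet> y + \<beta>' F))"
  let ?U = "upper_faces j Q" and ?L = "upper_faces (- j) Q"
  have int_g: "integrable (coord_measure (insert j D)) ?g"
    using set_integrable_cis_coord_measure[OF D(1) Q(1)] by (simp add: set_integrable_def)
  then have [measurable]: "?g \<in> borel_measurable borel"
    by (auto dest: borel_measurable_integrable)
  have int_f: "integrable (coord_measure D) (?f F)" if "F \<in> ?U \<union> ?L" for F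
  proof -
    have "F face_of Q" using that by (auto simp: upper_faces_def)
    then have "polytope (perp j ` F)"
      using Q(1) linear_perp by (metis face_of_polytope_polytope polytope_linear_image)
    then show ?thesis
      using set_integrable_cis_coord_measure[OF DB] by (simp add: set_integrable_def)
  qed
  have "\<i> * of_real (t * (\<alpha> \<bullet> j)) * (\<integral>x. ?g x \<partial>coord_measure (insert j D)) =
      (\<integral>y. \<i> * of_real (t * (\<alpha> \<bullet> j)) * (\<integral>s. ?g (y + s *\<^sub>R j) \<partial>lborel) \<partial>coord_measure D)"
    by (subst integral_coord_measure_insert[OF fD D(2) int_g]) (simp only: integral_mult_right_zero)
  also have "\<dots> = (\<integral>y. (\<Sum>F\<in>?U. ?f F y) - (\<Sum>F\<in>?L. ?f F y) \<partial>coord_measure D)"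
  proof (rule integral_cong_AE)
    show "(\<lambda>y. \<i> * of_real (t * (\<alpha> \<bullet> j)) * (\<integral>s. ?g (y + s *\<^sub>R j) \<partial>lborel)) \<in> borel_measurable (coord_measure D)"
      by measurable
    show "(\<lambda>y. (\<Sum>F\<in>?U. ?f F y) - (\<Sum>F\<in>?L. ?f F y)) \<in> borel_measurable (coord_measure D)"
      using int_f by (intro borel_measurable_diff borel_measurable_sum) (auto dest: borel_measurable_integrable)
    show "AE y in coord_measure D. \<i> * of_real (t * (\<alpha> \<bullet> j)) * (\<integral>s. ?g (y + s *\<^sub>R j) \<partial>lborel) =
        (\<Sum>F\<in>?U. ?f F y) - (\<Sum>F\<in>?L. ?f F y)"
      using AE_generic_line[OF D Q(1,2)]
    proof eventually_elim
      case (elim y)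
      show ?case
      proof (cases "y \<in> perp j ` Q")
        case True
        then have "y \<in> rel_interior (perp j ` Q)" using elim by blast
        then show ?thesis
          using elim form by (intro line_integral_polytope[OF Q(1) j dir]) blast+
      next
        case False
        \<comment> \<open>Since \<open>y\<close> is in \<open>span D\<close>, the whole line through
          it projects to \<open>y\<close>, which is outside the projection of \<open>Q\<close>; both
          sides are then 0.\<close>
        have "y + s *\<^sub>R j \<notin> Q" for s
        proof
          assume s: "y + s *\<^sub>R j \<in> Q"
          have "perp j (y + s *\<^sub>R j) = y"
            using elim perp_fix_span[OF D] by (simp add: perp_add_direction[OF j])
          then show False using False s by (metis imageI)
        qed
        moreover have "y \<notin> perp j ` F" if "F \<in> ?U \<union> ?L" for F
          using False that by (auto simp: upper_faces_def)
        ultimately show ?thesis by simp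
      qed
    qed
  qed
  also have "\<dots> = (\<integral>y. (\<Sum>F\<in>?U. ?f F y) \<partial>coord_measure D) - (\<integral>y. (\<Sum>F\<in>?L. ?f F y) \<partial>coord_measure D)"
    using int_f by (intro Bochner_Integration.integral_diff Bochner_Integration.integrable_sum) auto
  also have "\<dots> = (\<Sum>F\<in>?U. \<integral>y. ?f F y \<partial>coord_measure D) - (\<Sum>F\<in>?L. \<integral>y. ?f F y \<partial>coord_measure D)"
    using int_f by (intro arg_cong2[of _ _ _ _ "(-)"] Bochner_Integration.integral_sum) auto
  finally show ?thesis
    by (simp only: set_lebesgue_integral_def)
qed

text \<open>The exponential sum representation is required for all \<^term>\<open>t\<close>, including
  \<^term>\<open>t = 0\<close>, where it says that the coefficients add up to \<^term>\<open>0\<close>.\<close>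

lemma fourier_polytope_exponential_sum:
  fixes Q :: "'a::euclidean_space set" and \<alpha> :: 'a and \<beta> :: real
  assumes R: "finite R"
    and "D \<subseteq> Basis" "polytope Q" "Q \<subseteq> span D"
    and "\<And>G. G face_of Q \<Longrightarrow> aff_dim G > 0 \<Longrightarrow> \<not> (\<lambda>x. \<alpha> \<bullet> x) constant_on G"
    and "\<And>v. v extreme_point_of Q \<Longrightarrow> \<alpha> \<bullet> v + \<beta> \<in> R"
  shows "\<exists>c. \<forall>t::real. of_real t ^ card D * (LINT x:Q|coord_measure D. cis (t * (\<alpha> \<bullet> x + \<beta>))) =
    (\<Sum>r\<in>R. c r * cis (t * r))"
  using assms(2-)
\<comment> \<open>The form must be general, since projecting a face changes it along with
  \<open>D\<close> and \<open>Q\<close>; only the frequency set \<open>R\<close> stays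
  fixed.\<close>
proof (induction "card D" arbitrary: D Q \<alpha> \<beta>)
  case 0
  have "D = {}"
    using 0 finite_subset[OF \<open>D \<subseteq> Basis\<close>] by simp
  \<comment> \<open>For empty \<open>D\<close> the measure is the unit point mass at 0.\<close>
  have int: "(LINT x:Q|coord_measure D. cis (t * (\<alpha> \<bullet> x + \<beta>))) = indicator Q 0 *\<^sub>R cis (t * \<beta>)" for t
  proof -
    have "Q \<in> sets borel" using polytope_imp_closed[OF \<open>polytope Q\<close>] by simp
    then have "(\<lambda>x. indicator Q x *\<^sub>R cis (t * (\<alpha> \<bullet> x + \<beta>))) \<in> borel_measurable borel"
      by (intro borel_measurable_scaleR borel_measurable_indicator borel_measurable_continuous_onI continuous_intros)
    then show ?thesis
      by (simp add: set_lebesgue_integral_def coord_measure_def \<open>D = {}\<close> integral_distr PiM_empty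
        lebesgue_integral_count_space_finite)
  qed
  show ?case
  proof (cases "0 \<in> Q")
    case True
    then have "Q = {0}" using \<open>Q \<subseteq> span D\<close> \<open>D = {}\<close> by auto
    then have "\<beta> \<in> R" using "0.prems"(5)[of 0] by (simp add: extreme_point_of_def)
    have "(\<Sum>r\<in>R. (if r = \<beta> then 1 else 0) * cis (t * r)) = cis (t * \<beta>)" for t
    proof -
      have "(\<Sum>r\<in>R. (if r = \<beta> then 1 else 0) * cis (t * r)) = (\<Sum>r\<in>R. if r = \<beta> then cis (t * r) else 0)"
        by (intro sum.cong) auto
      then show ?thesis using R \<open>\<beta> \<in> R\<close> by simp
    qed
    then show ?thesis
      using True int "0.hyps" by (intro exI[of _ "\<lambda>r. if r = \<beta> then 1 else 0"]) simp
  next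
    case False
    then show ?thesis
      using int by (intro exI[of _ "\<lambda>r. 0"]) simp
  qed
next
  case (Suc n)
  note prems = Suc.prems
  show ?case
  proof (cases "aff_dim Q < int (card D)")
    case True
    \<comment> \<open>A degenerate polytope is a null set. This case occurs for projections of faces
      smaller than facets.\<close>
    have "(LINT x:Q|coord_measure D. cis (t * (\<alpha> \<bullet> x + \<beta>))) = 0" for t
      unfolding set_lebesgue_integral_def
      by (rule integral_eq_zero_AE)
        (use AE_coord_measure_low_dim[OF prems(1,3) True] in eventually_elim, simp)
    then show ?thesis by (intro exI[of _ "\<lambda>r. 0"]) simp
  next
    case False
    then have dimQ: "aff_dim Q = int (card D)"
      using aff_dim_le_card[OF prems(1,3)] by simp
    \<comment> \<open>\<open>Q\<close> is a face of itself of dimension \<open>Suc n\<close>, so the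
      form varies on it and cannot be orthogonal to all of \<open>D\<close>.\<close>
    have "\<not> (\<lambda>x. \<alpha> \<bullet> x) constant_on Q"
      using dimQ Suc.hyps(2) polytope_imp_convex[OF prems(2)] by (intro prems(4)) (auto intro: face_of_refl)
    moreover have "(\<lambda>x. \<alpha> \<bullet> x) constant_on Q" if "\<forall>b\<in>D. \<alpha> \<bullet> b = 0"
    proof -
      have "orthogonal \<alpha> x" if "x \<in> Q" for x
        using that prems(3) \<open>\<forall>b\<in>D. \<alpha> \<bullet> b = 0\<close>
        by (intro orthogonal_to_span[of x D]) (auto simp: orthogonal_def)
      then show ?thesis by (auto simp: constant_on_def orthogonal_def)
    qed
    ultimately obtain j where j: "j \<in> D" "\<alpha> \<bullet> j \<noteq> 0" by blast
    define E where "E = D - {j}"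
    have fD: "finite D" using finite_subset[OF prems(1)] by simp
    have E: "insert j E = D" "j \<notin> E" "card E = n" "E \<subseteq> Basis"
      using j fD Suc.hyps(2) prems(1) by (auto simp: E_def)
    have nj: "norm j = 1" using j(1) prems(1) by (auto simp: norm_Basis)
    let ?W = "upper_faces j Q \<union> upper_faces (- j) Q"
    \<comment> \<open>Bundling the compatibility of the forms with the induction result lets a
      single choice over the faces provide \<open>\<alpha>'\<close>, \<open>\<beta>'\<close> and
      \<open>c\<close> together.\<close>
    define \<Phi> where "\<Phi> F \<alpha>' \<beta>' c \<longleftrightarrow> (\<forall>x\<in>F. \<alpha>' \<bullet> perp j x + \<beta>' = \<alpha> \<bullet> x + \<beta>) \<and>
        (\<forall>t::real. of_real t ^ n * (LINT y:perp j ` F|coord_measure E. cis (t * (\<alpha>' \<bullet> y + \<beta>'))) =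
          (\<Sum>r\<in>R. c r * cis (t * r)))" for F \<alpha>' \<beta>' and c :: "real \<Rightarrow> complex"
    have "\<exists>\<alpha>' \<beta>' c. \<Phi> F \<alpha>' \<beta>' c" if F: "F \<in> ?W" for F
    proof -
      obtain a b where ab: "F \<subseteq> {x. a \<bullet> x = b}" "a \<bullet> j \<noteq> 0"
        using F by (fastforce simp: upper_faces_def)
      have FQ: "F face_of Q" using F by (auto simp: upper_faces_def)
      define \<alpha>' where "\<alpha>' = \<alpha> - (\<alpha> \<bullet> j / (a \<bullet> j)) *\<^sub>R perp j a"
      define \<beta>' where "\<beta>' = \<beta> + \<alpha> \<bullet> j * b / (a \<bullet> j)"
      have shear: "\<alpha>' \<bullet> y + \<beta>' = \<alpha> \<bullet> shear j a b y + \<beta>" for y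
        unfolding \<alpha>'_def \<beta>'_def by (rule affine_form_shear[symmetric])
      \<comment> \<open>Faces of the projection come from faces of \<open>F\<close>, hence of
        \<open>Q\<close>. Through this both hypotheses on the form pass to the projected
        face.\<close>
      have lift: "shear j a b ` G face_of Q" if "G face_of perp j ` F" for G
        using that face_of_shear[OF nj, of a b G "perp j ` F"] shear_image_perp[OF nj ab(2,1)] FQ
        by (metis face_of_trans)
      have "\<forall>x\<in>F. \<alpha>' \<bullet> perp j x + \<beta>' = \<alpha> \<bullet> x + \<beta>"
        using ab by (auto simp: shear shear_perp[OF nj])
      moreover have "\<exists>c. \<forall>t::real. of_real t ^ card E *
          (LINT y:perp j ` F|coord_measure E. cis (t * (\<alpha>' \<bullet> y + \<beta>'))) = (\<Sum>r\<in>R. c r * cis (t * r))"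
      proof (rule Suc.hyps(1))
        show "n = card E" "E \<subseteq> Basis" using E by auto
        show "polytope (perp j ` F)"
          using FQ prems(2) linear_perp by (metis face_of_polytope_polytope polytope_linear_image)
        show "perp j ` F \<subseteq> span E"
          using face_of_imp_subset[OF FQ] prems(1,3) perp_in_span[of j E] E by auto
        show "\<not> (\<lambda>x. \<alpha>' \<bullet> x) constant_on G" if G: "G face_of perp j ` F" "aff_dim G > 0" for G
        proof
          assume "(\<lambda>x. \<alpha>' \<bullet> x) constant_on G"
          then obtain c where c: "\<And>y. y \<in> G \<Longrightarrow> \<alpha>' \<bullet> y = c" by (auto simp: constant_on_def)
          have "\<alpha> \<bullet> shear j a b y = c + \<beta>' - \<beta>" if "y \<in> G" for y
            using shear[of y] c[OF that] by simp
          then have "(\<lambda>x. \<alpha> \<bullet> x) constant_on shear j a b ` G" by (auto simp: constant_on_def)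
          then show False
            using prems(4)[OF lift[OF G(1)]] G(2) by (simp add: aff_dim_shear[OF nj])
        qed
        \<comment> \<open>A vertex of the projection lifts to a vertex of \<open>Q\<close> with the
          same value of the form, so no new frequency appears.\<close>
        show "\<alpha>' \<bullet> v + \<beta>' \<in> R" if "v extreme_point_of perp j ` F" for v
          using lift[of "{v}"] prems(5)[of "shear j a b v"] that by (simp add: shear face_of_singleton)
      qed
      ultimately show ?thesis unfolding \<Phi>_def E(3) by blast
    qed
    then obtain \<alpha>' \<beta>' c where "\<And>F. F \<in> ?W \<Longrightarrow> \<Phi> F (\<alpha>' F) (\<beta>' F) (c F)"
      by metis
    then have form: "\<And>F x. F \<in> ?W \<Longrightarrow> x \<in> F \<Longrightarrow> \<alpha>' F \<bullet> perp j x + \<beta>' F = \<alpha> \<bullet> x + \<beta>"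
      and c: "\<And>F t. F \<in> ?W \<Longrightarrow> of_real t ^ n *
        (LINT y:perp j ` F|coord_measure E. cis (t * (\<alpha>' F \<bullet> y + \<beta>' F))) = (\<Sum>r\<in>R. c F r * cis (t * r))"
      unfolding \<Phi>_def by blast+
    \<comment> \<open>Only the nonzero constant \<open>\<i> * of_real (\<alpha> \<bullet> j)\<close>
      is divided out; the factor t joins the power on the left.\<close>
    define C where "C r = ((\<Sum>F\<in>upper_faces j Q. c F r) - (\<Sum>F\<in>upper_faces (- j) Q. c F r)) / (\<i> * of_real (\<alpha> \<bullet> j))" for r
    have "of_real t ^ card D * (LINT x:Q|coord_measure D. cis (t * (\<alpha> \<bullet> x + \<beta>))) = (\<Sum>r\<in>R. C r * cis (t * r))" for t
    proof -
      let ?I = "LINT x:Q|coord_measure D. cis (t * (\<alpha> \<bullet> x + \<beta>))"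
      let ?J = "\<lambda>F. LINT y:perp j ` F|coord_measure E. cis (t * (\<alpha>' F \<bullet> y + \<beta>' F))"
      have slice: "\<i> * of_real (t * (\<alpha> \<bullet> j)) * ?I =
          (\<Sum>F\<in>upper_faces j Q. ?J F) - (\<Sum>F\<in>upper_faces (- j) Q. ?J F)"
        using fourier_slice_polytope[of j E Q \<alpha>' \<beta>' \<alpha> \<beta> t] form prems(1-3) dimQ E(1,2) by simp
      have "(\<i> * of_real (\<alpha> \<bullet> j)) * (of_real t ^ card D * ?I) = of_real t ^ n * (\<i> * of_real (t * (\<alpha> \<bullet> j)) * ?I)"
        using Suc.hyps(2)[symmetric] by simp
      also have "\<dots> = (\<Sum>F\<in>upper_faces j Q. of_real t ^ n * ?J F) - (\<Sum>F\<in>upper_faces (- j) Q. of_real t ^ n * ?J F)"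
        unfolding slice by (simp add: right_diff_distrib sum_distrib_left)
      also have "\<dots> = (\<Sum>F\<in>upper_faces j Q. \<Sum>r\<in>R. c F r * cis (t * r)) -
          (\<Sum>F\<in>upper_faces (- j) Q. \<Sum>r\<in>R. c F r * cis (t * r))"
        using c by simp
      also have "\<dots> = (\<Sum>r\<in>R. \<Sum>F\<in>upper_faces j Q. c F r * cis (t * r)) -
          (\<Sum>r\<in>R. \<Sum>F\<in>upper_faces (- j) Q. c F r * cis (t * r))"
        by (intro arg_cong2[of _ _ _ _ "(-)"] sum.swap)
      also have "\<dots> = (\<i> * of_real (\<alpha> \<bullet> j)) * (\<Sum>r\<in>R. C r * cis (t * r))"
        using j(2) unfolding sum_subtractf[symmetric] sum_distrib_right[symmetric] left_diff_distrib[symmetric]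
        by (simp add: C_def sum_distrib_left)
      finally show ?thesis using j(2) by simp
    qed
    then show ?thesis by blast
  qed
qed

section \<open>Edges, common denominators and the orthogonal family\<close>

text \<open>Passing to a facet lowers the dimension by exactly one, so the descent reaches dimension
  1. This extends the edge hypothesis to all faces of positive dimension.\<close>

lemma polytope_ex_edge:
  fixes P :: "'a::euclidean_space set"
  assumes "polytope P" "aff_dim P > 0"
  shows "\<exists>e. e edge_of P"
  using assms
proof (induction "nat (aff_dim P)" arbitrary: P)
  case 0
  then show ?case by simp
next
  case (Suc n)
  show ?case
  proof (cases "aff_dim P = 1")
    case True
    then show ?thesis
      using polytope_imp_convex[OF Suc.prems(1)] by (auto simp: edge_of_def intro!: face_of_refl)
  next
    case False
    obtain F where F: "F facet_of P"
      using polytope_facet_exists[OF Suc.prems] by blast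
    then have "F face_of P" "aff_dim F = aff_dim P - 1"
      by (auto simp: facet_of_def)
    moreover have "polytope F"
      using \<open>F face_of P\<close> Suc.prems(1) face_of_polytope_polytope by blast
    ultimately have "\<exists>e. e edge_of F"
      using False Suc.prems(2) Suc.hyps(2) by (intro Suc.hyps(1)) auto
    then show ?thesis
      using \<open>F face_of P\<close> by (auto simp: edge_of_def intro: face_of_trans)
  qed
qed

lemma finite_rats_common_denominator:
  fixes R :: "real set"
  assumes "finite R" "R \<subseteq> \<rat>"
  shows "\<exists>N::nat. N > 0 \<and> (\<forall>r\<in>R. of_nat N * r \<in> \<int>)"
  using assms
proof (induction R rule: finite_induct)
  case empty
  then show ?case by (intro exI[of _ 1]) simp
next
  case (insert r R)
  then obtain N :: nat where N: "N > 0" "\<forall>r\<in>R. of_nat N * r \<in> \<int>" by auto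
  obtain p q where pq: "r = of_int p / of_int q" "q > 0"
    using insert.prems by (auto elim: Rats_cases')
  define M where "M = N * nat q"
  have "of_nat M * r = of_int (int N * p)"
    using pq by (simp add: M_def)
  then have "of_nat M * r \<in> \<int>"
    by (metis Ints_of_int)
  moreover have "of_nat M * x \<in> \<int>" if "x \<in> R" for x
  proof -
    have "of_nat M * x = of_int q * (of_nat N * x)"
      using pq by (simp add: M_def)
    moreover have "of_nat N * x \<in> \<int>" using N(2) that by blast
    ultimately show ?thesis by (metis Ints_mult Ints_of_int)
  qed
  ultimately have "\<forall>x\<in>insert r R. of_nat M * x \<in> \<int>"
    by blast
  moreover have "M > 0" using N(1) pq(2) by (simp add: M_def)
  ultimately show ?case by blast
qed

theorem theorem2p2:
  fixes P :: "(real ^ 'd::finite) set" and k :: 'd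
  assumes "polytope P" and "emeasure lborel P > 0"
    and "\<And>v. v extreme_point_of P \<Longrightarrow> v $ k \<in> \<rat>"
    and "\<And>e c. e edge_of P \<Longrightarrow> \<not> e \<subseteq> {x. x $ k = c}"
  shows "\<exists>\<Lambda> :: (real ^ 'd) set. countable \<Lambda> \<and> infinite \<Lambda> \<and>
    (\<forall>\<xi>\<in>\<Lambda>. \<forall>\<mu>\<in>\<Lambda>. \<xi> \<noteq> \<mu> \<longrightarrow>
      (LINT x:P|lborel. exp (\<i> * complex_of_real ((\<xi> - \<mu>) \<bullet> x))) = 0)"
proof -
  let ?e = "axis k 1 :: real ^ 'd"
  define R where "R = (\<lambda>v. v $ k) ` {v. v extreme_point_of P}"
  have R: "finite R" "R \<subseteq> \<rat>"
    using finite_polyhedron_extreme_points[OF polytope_imp_polyhedron[OF assms(1)]] assms(3)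
    by (auto simp: R_def)
  have "\<not> (\<lambda>x. ?e \<bullet> x) constant_on G" if G: "G face_of P" "aff_dim G > 0" for G
  proof
    assume "(\<lambda>x. ?e \<bullet> x) constant_on G"
    then obtain c where c: "\<And>x. x \<in> G \<Longrightarrow> x $ k = c"
      by (auto simp: constant_on_def inner_axis')
    have "polytope G" using G(1) assms(1) face_of_polytope_polytope by blast
    then obtain e where e: "e edge_of G" using polytope_ex_edge G(2) by blast
    then have "e edge_of P" "e \<subseteq> G"
      using G(1) by (auto simp: edge_of_def intro: face_of_trans dest: face_of_imp_subset)
    then show False using assms(4) c by blast
  qed
  then have "\<exists>c. \<forall>t::real. of_real t ^ card (Basis :: (real ^ 'd) set) *
      (LINT x:P|coord_measure Basis. cis (t * (?e \<bullet> x + 0))) = (\<Sum>r\<in>R. c r * cis (t * r))"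
    by (intro fourier_polytope_exponential_sum[OF R(1) _ assms(1)])
      (auto simp: R_def inner_axis' span_Basis)
  then obtain c where c: "\<And>t::real. of_real t ^ DIM(real ^ 'd) *
      (LINT x:P|lborel. cis (t * (?e \<bullet> x))) = (\<Sum>r\<in>R. c r * cis (t * r))"
    by (auto simp: coord_measure_Basis)
  \<comment> \<open>At t = 0 the left side vanishes because the dimension is positive, while every
    \<open>cis\<close> is 1.\<close>
  have c0: "(\<Sum>r\<in>R. c r) = 0"
    using c[of 0] by (simp add: power_0_left)
  obtain N :: nat where N: "N > 0" "\<forall>r\<in>R. of_nat N * r \<in> \<int>"
    using finite_rats_common_denominator[OF R] by blast
  have vanish: "(LINT x:P|lborel. cis (2 * pi * N * of_int m * (?e \<bullet> x))) = 0" if "m \<noteq> 0" for m :: int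
  proof -
    let ?t = "2 * pi * N * of_int m"
    have "cis (?t * r) = 1" if "r \<in> R" for r
    proof -
      have "of_nat N * r \<in> \<int>" using N(2) \<open>r \<in> R\<close> by blast
      then obtain q where "of_nat N * r = of_int q" by (rule Ints_cases)
      then have "?t * r = 2 * pi * of_int (m * q)" by (simp add: algebra_simps)
      then show ?thesis by (metis Ints_of_int cis_multiple_2pi)
    qed
    then have "of_real ?t ^ DIM(real ^ 'd) * (LINT x:P|lborel. cis (?t * (?e \<bullet> x))) = 0"
      using c[of ?t] c0 by simp
    then show ?thesis using that N(1) by simp
  qed
  \<comment> \<open>Integer multiples of one vector form a group, so every difference of two
    distinct members is again a nonzero multiple, where the transform vanishes.\<close>
  define freq where "freq m = (2 * pi * N * real_of_int m) *\<^sub>R ?e" for m :: int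
  have "inj freq"
    using N(1) by (auto simp: inj_def freq_def)
  then have "infinite (range freq)"
    using finite_imageD infinite_UNIV_int by blast
  moreover have "(LINT x:P|lborel. exp (\<i> * complex_of_real ((freq m - freq n) \<bullet> x))) = 0" if "freq m \<noteq> freq n" for m n
  proof -
    have "(freq m - freq n) \<bullet> x = 2 * pi * N * of_int (m - n) * (?e \<bullet> x)" for x
      by (simp add: freq_def algebra_simps inner_simps)
    then show ?thesis
      using vanish[of "m - n"] that by (auto simp: cis_conv_exp)
  qed
  ultimately show ?thesis
    by (intro exI[of _ "range freq"]) auto
qed

end
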